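(* Let $e_{\mathbb C}=24$, let $e_{\mathbb R}$ be a fixed even integer with $-18\le e_{\mathbb R}\le 20$, let $(w_n)_{n\ge 0}$ be the corresponding sequence of signed counts of real rational curves on primitively polarized real $K3$ surfaces whose real part has Euler characteristic $e_{\mathbb R}$, and let $(c_n)_{n\ge 0}$ be the sequence of counts of complex rational curves. The following asymptotic relations hold as $n\to\infty$: i) If $e_{\mathbb R}<0$, then $$\log w_n\sim \pi\sqrt{\frac{4(e_{\mathbb C}-3e_{\mathbb R})}{e_{\mathbb C}}\cdot n}\sim\sqrt{\frac{e_{\mathbb C}-3e_{\mathbb R}}{4e_{\mathbb C}}}\,\log c_n .$$ ii) If $e_{\mathbb R}>0$, then $$\log |w_n|\sim 2\pi\sqrt n\sim \frac12\log c_n .$$ iii) If $e_{\mathbb R}=0$, then $$\log w_{2n}\sim\frac12\log c_{2n}.$$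
   Context: Let $X$ be a generic real $K3$ surface admitting a complete real $g$-dimensional linear system of curves of genus $g$; if $g\ge 2$, assume in addition that $X$ has Picard rank $1$ and that the curves in the linear system belong to a primitive divisor class. Genericity ensures that all rational curves in the linear system are nodal. Let $c_g$ be the number of complex rational curves in this linear system, and let $w_g=n_+-n_-$ be the number of real rational curves in it counted with Welschinger sign: $n_+$ (resp. $n_-$) is the number of real rational curves in the system having an even (resp. odd) number of real solitary points. Let $e_{\mathbb R}$ be the Euler characteristic of the real part $X_{\mathbb R}$ (always even, between $-18$ and $20$) and $e_{\mathbb C}=24$ the Euler characteristic of $X$. It is known (taken as given) that $c_g$ depends only on $g$, that $w_g$ depends only on $g$ and $e_{\mathbb R}$, and that $$\sum_{g\ge 0} c_g q^g=\prod_{s\ge 1}\frac{1}{(1-q^{s})^{e_{\mathbb C}}},\qquad \sum_{g\ge 0} w_g q^g=\prod_{r\ge 1}\frac{1}{(1+q^r)^{e_{\mathbb R}}}\prod_{s\ge 1}\frac{1}{(1-q^{2s})^{\frac{e_{\mathbb C}-e_{\mathbb R}}{2}}}.$$ For fixed $e_{\mathbb R}$, $(w_g)_{g\ge0}$ denotes the sequence of coefficients of the second series. The notation $x_n\sim y_n$ means $x_n/y_n\to 1$ as $n\to\infty$. *)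

theory Defs
  imports "HOL-Analysis.Analysis" "HOL-Library.Landau_Symbols"
begin

abbreviation e_C :: int where
  "e_C \<equiv> 24"

text \<open>
  The curve counts on K3 surfaces enter only through their generating functions (the formulas of
  Yau--Zaslow and of Kharlamov--Rasdeaconu), whose coefficients are taken as the definition of
  the two sequences.  Infinite products are limits in the metric topology on formal power series;
  \<^const>\<open>prodinf\<close> starts at index \<open>0\<close>, hence the shift by \<^const>\<open>Suc\<close>.
\<close>

definition complex_count_gf :: "real fps" where
  "complex_count_gf = (\<Prod>s. 1 / (1 - fps_X ^ Suc s) powi e_C)"

definition real_count_gf :: "int \<Rightarrow> real fps" where
  "real_count_gf e_R =
     (\<Prod>r. 1 / (1 + fps_X ^ Suc r) powi e_R) *
     (\<Prod>s. 1 / (1 - fps_X ^ (2 * Suc s)) powi ((e_C - e_R) div 2))"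

definition complex_count :: "nat \<Rightarrow> real" where
  "complex_count n = fps_nth complex_count_gf n"

text \<open>The number \<open>w\<^sub>n\<close> for real K3 surfaces whose real part has Euler characteristic \<open>e_R\<close>
  (for even \<open>e_R\<close>, so that the \<open>div\<close> above is exact).\<close>

definition real_count :: "int \<Rightarrow> nat \<Rightarrow> real" where
  "real_count e_R n = fps_nth (real_count_gf e_R) n"

text \<open>The infinite products converge, i.e. \<^const>\<open>prodinf\<close> is the genuine limit in the
  definitions above, and each coefficient is that of a sufficiently long partial product.\<close>

definition one_mod_X :: "nat \<Rightarrow> real fps \<Rightarrow> bool" where
  "one_mod_X m f \<longleftrightarrow> (\<exists>h. f = 1 + fps_X ^ m * h)"

lemma one_mod_X_mult: assumes "one_mod_X m f" "one_mod_X m g" shows "one_mod_X m (f * g)"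
proof -
  obtain h k where "f = 1 + fps_X ^ m * h" "g = 1 + fps_X ^ m * k" using assms by (auto simp: one_mod_X_def)
  then have "f * g = 1 + fps_X ^ m * (h + k + fps_X ^ m * h * k)" by (simp add: algebra_simps)
  then show ?thesis unfolding one_mod_X_def by blast
qed

lemma one_mod_X_1: "one_mod_X m 1" unfolding one_mod_X_def by (rule exI[of _ 0]) simp

lemma one_mod_X_power: "one_mod_X m f \<Longrightarrow> one_mod_X m (f ^ k)"
  by (induction k) (auto intro: one_mod_X_mult one_mod_X_1)

lemma one_mod_X_nth0: "m > 0 \<Longrightarrow> one_mod_X m f \<Longrightarrow> fps_nth f 0 = 1"
  by (auto simp: one_mod_X_def)

lemma one_mod_X_inverse: assumes "m > 0" "one_mod_X m f" shows "one_mod_X m (inverse f)"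
proof -
  obtain h where h: "f = 1 + fps_X ^ m * h" using assms by (auto simp: one_mod_X_def)
  have "inverse f * f = 1" using one_mod_X_nth0[OF assms] by (intro inverse_mult_eq_1) auto
  then have "inverse f = 1 + fps_X ^ m * (- h * inverse f)" using h by (simp add: algebra_simps eq_diff_eq)
  then show ?thesis unfolding one_mod_X_def by blast
qed

lemma one_mod_X_powi: "m > 0 \<Longrightarrow> one_mod_X m f \<Longrightarrow> one_mod_X m (f powi e)"
  by (auto simp: power_int_def intro: one_mod_X_power one_mod_X_inverse)

lemma one_mod_X_div: "m > 0 \<Longrightarrow> one_mod_X m f \<Longrightarrow> one_mod_X m (1 / f)"
  using one_mod_X_inverse[of m f] one_mod_X_nth0[of m f] by (simp add: fps_divide_unit)

lemma nth_mult_one_mod_X: assumes "one_mod_X m f" "n < m" shows "fps_nth (P * f) n = fps_nth P n"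
proof -
  obtain h where h: "f = 1 + fps_X ^ m * h" using assms by (auto simp: one_mod_X_def)
  have "P * f = P + fps_X ^ m * (P * h)" using h by (simp add: algebra_simps)
  then show ?thesis using assms(2) by (simp add: fps_X_power_mult_nth)
qed

lemma has_prod_one_mod_X:
  assumes "\<And>k. one_mod_X (Suc k) (f k)"
  shows "f has_prod prodinf f" "\<And>n N. N \<ge> n \<Longrightarrow> fps_nth (prodinf f) n = fps_nth (\<Prod>k\<le>N. f k) n"
proof -
  define P where "P = Abs_fps (\<lambda>n. fps_nth (\<Prod>k\<le>n. f k) n)"
  have *: "fps_nth (\<Prod>k\<le>N. f k) n = fps_nth P n" if "N \<ge> n" for n N
    using that
  proof (induction N rule: dec_induct)
    case base then show ?case by (simp add: P_def)
  next
    case (step N) then show ?case using nth_mult_one_mod_X[OF assms, of n "Suc N"] by simp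
  qed
  have l: "(\<lambda>n. \<Prod>k\<le>n. f k) \<longlonglongrightarrow> P"
    using * by (intro tendsto_fpsI) (auto simp: eventually_at_top_linorder)
  have "fps_nth P 0 = 1" using one_mod_X_nth0[OF _ assms, of 0] by (simp add: P_def)
  then have "P \<noteq> 0" by auto
  then have "f has_prod P" using l by (auto simp: has_prod_def raw_has_prod_def)
  then show "f has_prod prodinf f" using has_prod_unique by blast
  then show "fps_nth (prodinf f) n = fps_nth (\<Prod>k\<le>N. f k) n" if "N \<ge> n" for n N
    using *[OF that] \<open>f has_prod P\<close> has_prod_unique by metis
qed

lemma one_mod_X_complex: "one_mod_X (Suc k) (1 / (1 - fps_X ^ Suc k) powi e)"
  by (intro one_mod_X_div one_mod_X_powi) (auto simp: one_mod_X_def intro: exI[of _ "-1"])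
lemma one_mod_X_real_plus: "one_mod_X (Suc k) (1 / (1 + fps_X ^ Suc k) powi e)"
  by (intro one_mod_X_div one_mod_X_powi) (auto simp: one_mod_X_def intro: exI[of _ "1"])
lemma one_mod_X_real_minus: "one_mod_X (Suc k) (1 / (1 - fps_X ^ (2 * Suc k)) powi e)"
  by (intro one_mod_X_div one_mod_X_powi) (auto simp: one_mod_X_def simp flip: power_add intro!: exI[of _ "- (fps_X ^ Suc k)"] simp: mult_2)

lemma count_products_converge:
  "(\<lambda>s. 1 / (1 - fps_X ^ Suc s) powi e_C) has_prod complex_count_gf"
  "(\<lambda>r. 1 / (1 + fps_X ^ Suc r :: real fps) powi e) has_prod (\<Prod>r. 1 / (1 + fps_X ^ Suc r) powi e)"
  "(\<lambda>r. 1 / (1 - fps_X ^ (2 * Suc r) :: real fps) powi e) has_prod (\<Prod>r. 1 / (1 - fps_X ^ (2* Suc r)) powi e)"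
  unfolding complex_count_gf_def by (rule has_prod_one_mod_X one_mod_X_complex one_mod_X_real_plus one_mod_X_real_minus)+

end

theory Submission
  imports Defs "HOL-Real_Asymp.Real_Asymp"
begin

text \<open>
  The counts grow like coefficients of products of partition type, and only their logarithms matter. For
  these it suffices to know the generating function along the positive real axis, once the coefficients are
  nonnegative and increasing.

  If \<open>u\<close> is such a sequence and the logarithm of its generating function at \<open>exp (- t)\<close> is asymptotic to
  \<open>C / t\<close> as \<open>t\<close> tends to 0 from the right, then \<open>ln (u n)\<close> is asymptotic to \<open>2 * sqrt (C * n)\<close>
  (\<open>tauberian_sqrt_growth\<close>). The constant \<open>C\<close> is additive over factors of the generating function, and for
  the product of the \<open>1 / (1 - q ^ k)\<close> it equals \<open>pi\<^sup>2 / 6\<close> (\<open>log_euler_at_0\<close>); replacing \<open>q\<close> by \<open>q ^ c\<close>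
  divides it by \<open>c\<close>. The complex counts have 24 such factors, hence \<open>C = 4 * pi\<^sup>2\<close>.

  For the real counts the product has to be brought into a form with nonnegative coefficients. For
  \<open>e_R < 0\<close> it already has this form, with the factors \<open>1 + q ^ k\<close> to the power \<open>- e_R\<close> and
  \<open>1 / (1 - q ^ (2 * k))\<close> to the power \<open>12 - e_R / 2\<close>. For \<open>e_R = 0\<close> it is the 12th power of the
  partition product in \<open>q\<^sup>2\<close>. For \<open>e_R > 0\<close>, Euler's identity between odd and distinct partitions
  replaces the factors \<open>1 / (1 + q ^ k)\<close> by \<open>1 - q ^ (2 * k - 1)\<close> (\<open>euler_odd_distinct\<close>), and
  substituting \<open>- q\<close> for \<open>q\<close> makes everything nonnegative (\<open>real_count_pos\<close>). So the counts alternate in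
  sign, and their absolute values are again governed by the positive axis.

  The coefficients increase in the cases \<open>e_R < 0\<close> and \<open>e_R > 0\<close> because
  \<open>(1 + q)\<^sup>2 / (1 - q\<^sup>2) = (1 + q) / (1 - q)\<close> divides the product with a nonnegative quotient. This uses that
  \<open>e_R\<close> is even, so that its absolute value is at least 2, and that \<open>12 - e_R / 2\<close> is positive.
\<close>

section \<open>A Tauberian theorem for the logarithms of coefficients\<close>

text \<open>
  Chernoff bounds on both tails. Multiplying \<open>exp (- (t * n))\<close> by \<open>exp ((t - t') * (n - N)) \<ge> 1\<close>
  for \<open>n \<ge> N\<close>, respectively by \<open>exp ((t'' - t) * (M - n)) \<ge> 1\<close> for \<open>n \<le> M\<close>, moves each tail to a
  value of \<open>U\<close> at another point; what remains are at most \<open>N\<close> terms with index between \<open>M\<close> and \<open>N\<close>,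
  and monotonicity bounds each of them through \<open>u N\<close>.
\<close>

lemma exponential_split:
  fixes u :: "nat \<Rightarrow> real" and U :: "real \<Rightarrow> real" and M :: real
  assumes nonneg: "\<And>n. u n \<ge> 0" and mono: "mono u"
    and U: "\<And>t::real. t > 0 \<Longrightarrow> (\<lambda>n. u n * exp (- (t * n))) sums U t"
    and t: "0 < t'" "t' \<le> t" "t \<le> t''"
  shows "U t \<le> exp (- (N * (t - t'))) * U t' + exp (M * (t'' - t)) * U t'' + N * (u N * exp (- (M * t)))"
proof -
  let ?g = "\<lambda>n. exp (- (N * (t - t'))) * (u n * exp (- (t' * n))) + exp (M * (t'' - t)) * (u n * exp (- (t'' * n)))
              + (if n \<in> {..<N} then u N * exp (- (M * t)) else 0)"
  have "u n * exp (- (t * n)) \<le> ?g n" for n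
  proof -
    have pos: "0 \<le> exp (- (N * (t - t'))) * (u n * exp (- (t' * n)))"
      "0 \<le> exp (M * (t'' - t)) * (u n * exp (- (t'' * n)))" "0 \<le> u N * exp (- (M * t))"
      using nonneg by auto
    consider "N \<le> n" | "n \<le> M" | "n < N" "M < n" by linarith
    then show ?thesis
    proof cases
      case 1
      have "0 \<le> (real n - N) * (t - t')" using 1 t by simp
      then have "exp (- (t * n)) \<le> exp (- (N * (t - t'))) * exp (- (t' * n))"
        by (simp add: algebra_simps flip: exp_add)
      from mult_left_mono[OF this nonneg[of n]] show ?thesis using pos 1 by (simp add: ac_simps)
    next
      case 2
      have "0 \<le> (M - n) * (t'' - t)" using 2 t by simp
      then have "exp (- (t * n)) \<le> exp (M * (t'' - t)) * exp (- (t'' * n))"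
        by (simp add: algebra_simps flip: exp_add)
      from mult_left_mono[OF this nonneg[of n]]
      have "u n * exp (- (t * n)) \<le> exp (M * (t'' - t)) * (u n * exp (- (t'' * n)))"
        by (simp add: ac_simps)
      then show ?thesis using pos by (smt (verit, best))
    next
      case 3
      have "M * t \<le> t * n" using 3 t by (simp add: mult.commute)
      then have "u n * exp (- (t * n)) \<le> u N * exp (- (M * t))"
        using 3 mono nonneg by (intro mult_mono) (auto simp: mono_def)
      then show ?thesis using pos 3 by simp
    qed
  qed
  moreover have "(\<lambda>n. u n * exp (- (t * n))) sums U t" using U t by simp
  moreover have "?g sums (exp (- (N * (t - t'))) * U t' + exp (M * (t'' - t)) * U t''
      + (\<Sum>n\<in>{..<N}. u N * exp (- (M * t))))"
    using t by (intro sums_add sums_mult U sums_If_finite_set) auto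
  ultimately have "U t \<le> exp (- (N * (t - t'))) * U t' + exp (M * (t'' - t)) * U t''
      + (\<Sum>n\<in>{..<N}. u N * exp (- (M * t)))"
    by (rule sums_le)
  then show ?thesis by simp
qed

text \<open>
  The saddle point of \<open>n * t + C / t\<close> is \<open>s = sqrt (C / n)\<close>, with value \<open>2 * sqrt (C * n)\<close>. The upper
  bound keeps only one term of the series at \<open>t = s\<close>. For the lower bound the series is taken at
  \<open>t = d * s\<close> with \<open>d\<close> slightly larger than 1. There its mass sits near the index \<open>n / d\<^sup>2\<close>, strictly inside
  the window from \<open>n / d^4\<close> to \<open>n\<close>, so both tails are negligible by the Chernoff bounds, and \<open>u n\<close> has to
  carry the window. Letting \<open>d\<close> tend to 1 closes the gap.
\<close>

theorem tauberian_sqrt_growth: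
  fixes u :: "nat \<Rightarrow> real" and l :: "real \<Rightarrow> real" and C :: real
  assumes nonneg: "\<And>n. u n \<ge> 0" and mono: "mono u"
    and U: "\<And>t::real. t > 0 \<Longrightarrow> (\<lambda>n. u n * exp (- t) ^ n) sums exp (l t)"
    and l: "((\<lambda>t. t * l t) \<longlongrightarrow> C) (at_right 0)" and C: "C > 0"
  shows "\<forall>\<^sub>F n in sequentially. u n > 0"
    and "(\<lambda>n. ln (u n)) \<sim>[sequentially] (\<lambda>n. 2 * sqrt (C * n))"
proof -
  have U': "(\<lambda>n. u n * exp (- (t * n))) sums exp (l t)" if "t > 0" for t :: real
    using U[OF that] by (simp add: mult.commute flip: exp_of_nat_mult)
  define s where "s N = sqrt (C / real N)" for N
  have s_pos: "s N > 0" if "N > 0" for N using that C by (simp add: s_def)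
  have s2: "s N * s N * N = C" if "N > 0" for N using that C by (simp add: s_def)
  have s_lim: "filterlim s (at_right 0) sequentially"
    unfolding s_def using C by real_asymp
  have inv_s: "filterlim (\<lambda>N. inverse (s N)) at_top sequentially"
    by (rule filterlim_compose[OF filterlim_inverse_at_top_right s_lim])
  have s_ln: "(\<lambda>N. s N * ln (3 * real N)) \<longlonglongrightarrow> 0"
    unfolding s_def using C by real_asymp
  have r: "(\<lambda>N. s N * l (c * s N)) \<longlonglongrightarrow> C / c" if "c > 0" for c
  proof -
    have "filterlim (\<lambda>N. c * s N) (at_right 0) sequentially"
      unfolding s_def using C that by real_asymp
    from filterlim_compose[OF l this] have "(\<lambda>N. c * s N * l (c * s N) / c) \<longlonglongrightarrow> C / c"
      using that by (intro tendsto_divide tendsto_const) auto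
    then show ?thesis using that by (simp add: mult.assoc)
  qed
  have lower: "\<forall>\<^sub>F N in sequentially. u N > 0 \<and> s N * l (d * s N) + C / d ^ 3 - s N * ln (3 * real N) \<le> s N * ln (u N)"
    if d: "d > 1" for d
  proof -
    \<comment> \<open>The exponents, relative to the value at \<open>d * s N\<close>, of the tail above \<open>N\<close> (moved to \<open>s N\<close>)
      and of the tail below \<open>N / d^4\<close> (moved to \<open>d\<^sup>2 * s N\<close>). Both limits of the brackets are negative multiples
      of \<open>(d - 1)\<^sup>2\<close>, so each tail eventually takes at most a third of the series.\<close>
    define e1 where "e1 N = (- (C * (d - 1)) + s N * l (1 * s N) - s N * l (d * s N)) * inverse (s N)" for N
    define e2 where "e2 N = (C * (d\<^sup>2 - d) / d ^ 4 + s N * l (d\<^sup>2 * s N) - s N * l (d * s N)) * inverse (s N)" for N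
    have "- (C * (d - 1)) + C / 1 - C / d = - C * (d - 1)\<^sup>2 / d"
      using d by (simp add: field_simps power2_eq_square)
    also have "\<dots> < 0" using C d by (simp add: field_simps)
    finally have neg: "- (C * (d - 1)) + C / 1 - C / d < 0" .
    have "(\<lambda>N. - (C * (d - 1)) + s N * l (1 * s N) - s N * l (d * s N)) \<longlonglongrightarrow> - (C * (d - 1)) + C / 1 - C / d"
      using d by (intro tendsto_diff tendsto_add tendsto_const r) auto
    then have "filterlim e1 at_bot sequentially"
      unfolding e1_def using neg by (rule filterlim_tendsto_neg_mult_at_bot[OF _ _ inv_s])
    then have E1: "\<forall>\<^sub>F N in sequentially. e1 N \<le> ln (1/3)" by (simp add: filterlim_at_bot)
    have "C * (d\<^sup>2 - d) / d ^ 4 + C / d\<^sup>2 - C / d = - C * (d - 1)\<^sup>2 / d ^ 3"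
      using d by (simp add: field_simps power2_eq_square power3_eq_cube power4_eq_xxxx)
    also have "\<dots> < 0" using C d by (simp add: field_simps)
    finally have neg: "C * (d\<^sup>2 - d) / d ^ 4 + C / d\<^sup>2 - C / d < 0" .
    have "(\<lambda>N. C * (d\<^sup>2 - d) / d ^ 4 + s N * l (d\<^sup>2 * s N) - s N * l (d * s N)) \<longlonglongrightarrow> C * (d\<^sup>2 - d) / d ^ 4 + C / d\<^sup>2 - C / d"
      using d by (intro tendsto_diff tendsto_add tendsto_const r) auto
    then have "filterlim e2 at_bot sequentially"
      unfolding e2_def using neg by (rule filterlim_tendsto_neg_mult_at_bot[OF _ _ inv_s])
    then have E2: "\<forall>\<^sub>F N in sequentially. e2 N \<le> ln (1/3)" by (simp add: filterlim_at_bot)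
    show ?thesis
      using E1 E2 eventually_gt_at_top[of 0]
    proof eventually_elim
      case (elim N)
      define \<sigma> where "\<sigma> = s N"
      have \<sigma>: "\<sigma> > 0" "\<sigma> * \<sigma> * N = C" using s_pos s2 elim by (auto simp: \<sigma>_def)
      have C\<sigma>: "C / \<sigma> = \<sigma> * N" using \<sigma> by (simp add: field_simps)
      have "e1 N = - (N * (d * \<sigma> - \<sigma>)) + l \<sigma> - l (d * \<sigma>)"
        unfolding e1_def \<sigma>_def[symmetric] \<sigma>(2)[symmetric] using \<sigma>(1) by (simp add: field_simps)
      then have "exp (- (N * (d * \<sigma> - \<sigma>)) + l \<sigma> - l (d * \<sigma>)) \<le> exp (ln (1/3))"
        using elim(1) by (subst exp_le_cancel_iff) simp
      then have 1: "exp (- (N * (d * \<sigma> - \<sigma>))) * exp (l \<sigma>) \<le> exp (l (d * \<sigma>)) / 3"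
        by (simp add: exp_add exp_diff exp_minus field_simps)
      have "e2 N = N / d ^ 4 * (d\<^sup>2 * \<sigma> - d * \<sigma>) + l (d\<^sup>2 * \<sigma>) - l (d * \<sigma>)"
        unfolding e2_def \<sigma>_def[symmetric] \<sigma>(2)[symmetric] using \<sigma>(1) d by (simp add: field_simps)
      then have "exp (N / d ^ 4 * (d\<^sup>2 * \<sigma> - d * \<sigma>) + l (d\<^sup>2 * \<sigma>) - l (d * \<sigma>)) \<le> exp (ln (1/3))"
        using elim(2) by (subst exp_le_cancel_iff) simp
      then have 2: "exp (N / d ^ 4 * (d\<^sup>2 * \<sigma> - d * \<sigma>)) * exp (l (d\<^sup>2 * \<sigma>)) \<le> exp (l (d * \<sigma>)) / 3"
        by (simp add: exp_add exp_diff exp_minus field_simps)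
      have "exp (l (d * \<sigma>)) \<le> exp (- (N * (d * \<sigma> - \<sigma>))) * exp (l \<sigma>)
          + exp (N / d ^ 4 * (d\<^sup>2 * \<sigma> - d * \<sigma>)) * exp (l (d\<^sup>2 * \<sigma>))
          + N * (u N * exp (- (N / d ^ 4 * (d * \<sigma>))))"
        using d \<sigma> by (intro exponential_split nonneg mono U') (auto simp: power2_eq_square)
      then have 3: "exp (l (d * \<sigma>)) \<le> 3 * N * (u N * exp (- (N / d ^ 4 * (d * \<sigma>))))"
        using 1 2 by linarith
      then have "0 < 3 * N * (u N * exp (- (N / d ^ 4 * (d * \<sigma>))))"
        using exp_gt_zero less_le_trans by blast
      then have upos: "u N > 0" by (simp add: zero_less_mult_iff)
      have "l (d * \<sigma>) \<le> ln (3 * N * (u N * exp (- (N / d ^ 4 * (d * \<sigma>)))))"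
        using 3 upos elim(3) by (subst ln_ge_iff) auto
      also have "\<dots> = ln (3 * real N) + ln (u N) - N * \<sigma> / d ^ 3"
        using upos elim(3) d by (simp add: ln_mult power4_eq_xxxx power3_eq_cube)
      finally have "\<sigma> * l (d * \<sigma>) \<le> \<sigma> * (ln (3 * real N) + ln (u N) - N * \<sigma> / d ^ 3)"
        using \<sigma> by (intro mult_left_mono) auto
      also have "\<dots> = \<sigma> * ln (3 * real N) + \<sigma> * ln (u N) - C / d ^ 3"
        unfolding \<sigma>(2)[symmetric] by (simp add: algebra_simps)
      finally show ?case using upos by (simp add: \<sigma>_def)
    qed
  qed
  show pos: "\<forall>\<^sub>F n in sequentially. u n > 0"
    using lower[of 2] by (auto elim: eventually_mono)
  have upper: "\<forall>\<^sub>F N in sequentially. s N * ln (u N) \<le> C + s N * l (1 * s N)"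
    using pos eventually_gt_at_top[of 0]
  proof eventually_elim
    case (elim N)
    have "u N * exp (- (s N * N)) \<le> exp (l (s N))"
      using U'[OF s_pos[OF elim(2)]] nonneg
        sum_le_suminf[of "\<lambda>n. u n * exp (- (s N * n))" "{N}"]
      by (auto simp: sums_iff)
    then have "ln (u N * exp (- (s N * N))) \<le> l (s N)"
      using elim by (subst ln_exp[of "l (s N)", symmetric], subst ln_le_cancel_iff) auto
    then have "ln (u N) \<le> s N * N + l (s N)"
      using elim by (simp add: ln_mult)
    from mult_left_mono[OF this, of "s N"] show ?case
      using s_pos s2 elim by (simp add: algebra_simps less_imp_le)
  qed
  \<comment> \<open>The upper bound tends to \<open>2 * C\<close>, the lower one to \<open>C / d + C / d^3\<close>, which exceeds any
    \<open>y < 2 * C\<close> once \<open>d\<close> is close to 1.\<close>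
  have "(\<lambda>N. s N * ln (u N)) \<longlonglongrightarrow> 2 * C"
  proof (rule order_tendstoI)
    fix y assume "y < 2 * C"
    moreover have "((\<lambda>d. C / d + C / d ^ 3) \<longlongrightarrow> C / 1 + C / 1 ^ 3) (at_right 1)"
      by (intro tendsto_intros) auto
    ultimately have "\<forall>\<^sub>F d in at_right 1. y < C / d + C / d ^ 3"
      by (intro order_tendstoD) auto
    then have "\<forall>\<^sub>F d in at_right 1. d > 1 \<and> y < C / d + C / d ^ 3"
      by (intro eventually_conj eventually_at_right_less)
    then obtain d where d: "d > 1" "y < C / d + C / d ^ 3"
      by (metis (no_types, lifting) eventually_happens trivial_limit_at_right_real)
    have "(\<lambda>N. s N * l (d * s N) + C / d ^ 3 - s N * ln (3 * real N)) \<longlonglongrightarrow> C / d + C / d ^ 3 - 0"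
      using d by (intro tendsto_diff tendsto_add tendsto_const r s_ln) auto
    then have "\<forall>\<^sub>F N in sequentially. y < s N * l (d * s N) + C / d ^ 3 - s N * ln (3 * real N)"
      using d by (intro order_tendstoD) auto
    with lower[OF d(1)] show "\<forall>\<^sub>F N in sequentially. y < s N * ln (u N)"
      by eventually_elim linarith
  next
    fix y assume "2 * C < y"
    moreover have "(\<lambda>N. C + s N * l (1 * s N)) \<longlonglongrightarrow> C + C / 1"
      by (intro tendsto_add tendsto_const r) auto
    ultimately have "\<forall>\<^sub>F N in sequentially. C + s N * l (1 * s N) < y"
      by (intro order_tendstoD) auto
    with upper show "\<forall>\<^sub>F N in sequentially. s N * ln (u N) < y"
      by eventually_elim linarith
  qed
  then have "(\<lambda>N. s N * ln (u N) / (2 * C)) \<longlonglongrightarrow> 2 * C / (2 * C)"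
    using C by (intro tendsto_divide tendsto_const) auto
  moreover have "\<forall>\<^sub>F N in sequentially. s N * ln (u N) / (2 * C) = ln (u N) / (2 * sqrt (C * N))"
    using eventually_gt_at_top[of 0]
  proof eventually_elim
    case (elim N)
    have "s N * sqrt (C * N) = C"
      using elim C by (simp add: s_def flip: real_sqrt_mult)
    then have "2 * C = s N * (2 * sqrt (C * N))" by linarith
    then have "s N * ln (u N) / (2 * C) = s N * ln (u N) / (s N * (2 * sqrt (C * N)))"
      by (simp only:)
    also have "\<dots> = ln (u N) / (2 * sqrt (C * N))"
      using s_pos[OF elim] by simp
    finally show ?case .
  qed
  ultimately show "(\<lambda>n. ln (u n)) \<sim>[sequentially] (\<lambda>n. 2 * sqrt (C * n))"
    using C by (intro asymp_equivI') (simp add: tendsto_cong)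
qed

section \<open>The logarithm of Euler's product near the boundary\<close>

text \<open>
  Both series are iterated sums of the nonnegative double series with terms
  \<open>x ^ ((m + 1) * (k + 1)) / (m + 1)\<close>: summing over \<open>m\<close> first gives the logarithm, summing over \<open>k\<close>
  first gives a geometric series.
\<close>

lemma lambert_double_series:
  fixes x :: real
  assumes x: "0 \<le> x" "x < 1"
  obtains S where "(\<lambda>k. - ln (1 - x ^ Suc k)) sums S"
    and "(\<lambda>m. x ^ Suc m / (Suc m * (1 - x ^ Suc m))) sums S"
proof -
  define f where "f = (\<lambda>(m, k). x ^ (Suc m * Suc k) / Suc m)"
  have pow_lt: "x ^ Suc k < 1" for k
    using x by (simp add: power_less_one_iff del: power_Suc)
  have row: "((\<lambda>k. f (m, k)) has_sum x ^ Suc m / (Suc m * (1 - x ^ Suc m))) UNIV" for m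
  proof -
    have "(\<lambda>k. (x ^ Suc m) ^ k) sums (1 / (1 - x ^ Suc m))"
      using x pow_lt[of m] by (intro geometric_sums) simp
    from sums_mult[OF this, of "x ^ Suc m / Suc m"]
    have "(\<lambda>k. x ^ Suc m / Suc m * (x ^ Suc m) ^ k) sums (x ^ Suc m / (Suc m * (1 - x ^ Suc m)))"
      by (simp del: power_Suc)
    moreover have "f (m, k) = x ^ Suc m / Suc m * (x ^ Suc m) ^ k" for k
      by (simp only: f_def case_prod_conv mult_Suc_right power_add power_mult) simp
    ultimately have "(\<lambda>k. f (m, k)) sums (x ^ Suc m / (Suc m * (1 - x ^ Suc m)))"
      by simp
    then show ?thesis using x by (intro sums_nonneg_imp_has_sum) (auto simp: f_def)
  qed
  have col: "((\<lambda>m. f (m, k)) has_sum - ln (1 - x ^ Suc k)) UNIV" for k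
  proof -
    have "(\<lambda>n. - ((- (- (x ^ Suc k))) ^ n) / real n) sums ln (1 + - (x ^ Suc k))"
      using x pow_lt[of k] by (intro ln_series') simp
    from sums_minus[OF this] have "(\<lambda>n. (x ^ Suc k) ^ n / real n) sums - ln (1 - x ^ Suc k)"
      by simp
    then have "(\<lambda>m. (x ^ Suc k) ^ Suc m / real (Suc m)) sums - ln (1 - x ^ Suc k)"
      by (subst sums_Suc_iff) simp
    then have "(\<lambda>m. f (m, k)) sums - ln (1 - x ^ Suc k)"
      by (simp only: f_def case_prod_conv power_mult[symmetric] mult.commute)
    then show ?thesis using x by (intro sums_nonneg_imp_has_sum) (auto simp: f_def)
  qed
  have "(\<lambda>m. x ^ Suc m / (Suc m * (1 - x ^ Suc m))) summable_on UNIV"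
  proof (rule summable_nonneg_imp_summable_on)
    have "summable (\<lambda>m. x ^ m / (1 - x))"
      using x by (intro summable_divide summable_geometric) simp
    then show "summable (\<lambda>m. x ^ Suc m / (Suc m * (1 - x ^ Suc m)))"
    proof (rule summable_comparison_test'[where N = 0])
      fix m :: nat
      have le: "x ^ Suc m \<le> x"
        using x power_decreasing[of 1 "Suc m" x] by simp
      have "x ^ Suc m / (Suc m * (1 - x ^ Suc m)) \<le> x ^ m / (1 * (1 - x))"
        using x le pow_lt[of m] by (intro frac_le mult_mono power_decreasing) auto
      then show "norm (x ^ Suc m / (Suc m * (1 - x ^ Suc m))) \<le> x ^ m / (1 - x)"
        using x pow_lt[of m] by simp
    qed
  qed (use x pow_lt in \<open>auto simp: less_imp_le\<close>)
  then have "f summable_on (UNIV \<times> UNIV)"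
    using x row by (intro summable_on_SigmaI[where g = "\<lambda>m. x ^ Suc m / (Suc m * (1 - x ^ Suc m))"])
      (auto simp: f_def)
  then obtain S where S: "(f has_sum S) (UNIV \<times> UNIV)" by (auto simp: summable_on_def)
  from has_sum_SigmaD[OF this row]
  have "(\<lambda>m. x ^ Suc m / (Suc m * (1 - x ^ Suc m))) sums S" by (rule has_sum_imp_sums)
  moreover have "((\<lambda>(k, m). f (m, k)) has_sum S) (UNIV \<times> UNIV)"
    using S by (subst (asm) has_sum_swap)
  then have "(\<lambda>k. - ln (1 - x ^ Suc k)) sums S"
    by (rule has_sum_imp_sums[OF has_sum_SigmaD]) (simp add: col del: power_Suc)
  ultimately show ?thesis using that by blast
qed

text \<open>
  The logarithm of the generating function of partitions at the point \<open>exp (- t)\<close>.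
\<close>

definition log_euler :: "real \<Rightarrow> real" where
  "log_euler t = (\<Sum>k. - ln (1 - exp (- t) ^ Suc k))"

lemma log_euler_sums: "(t::real) > 0 \<Longrightarrow> (\<lambda>k. - ln (1 - exp (- t) ^ Suc k)) sums log_euler t"
  unfolding log_euler_def by (rule lambert_double_series[of "exp (- t)"]) (auto simp: sums_iff)

text \<open>
  In the Lambert form, \<open>t * log_euler t\<close> has the terms \<open>t / ((m + 1) * (exp ((m + 1) * t) - 1))\<close>. Each
  of them tends to \<open>1 / (m + 1)\<^sup>2\<close> and is bounded by it, because \<open>exp y - 1 \<ge> y\<close>. Tannery's theorem and
  Euler's value of the sum of the inverse squares give the limit.
\<close>

lemma log_euler_at_0: "((\<lambda>t. t * log_euler t) \<longlongrightarrow> pi\<^sup>2 / 6) (at_right 0)"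
proof -
  define a where "a m t = t * (exp (- t) ^ Suc m / (Suc m * (1 - exp (- t) ^ Suc m)))" for m and t :: real
  have a_eq: "a m t = t / (Suc m * (exp (Suc m * t) - 1))" if "t > 0" for m and t :: real
  proof -
    have "exp (- t) ^ Suc m = inverse (exp (Suc m * t))"
      by (simp only: exp_of_nat_mult[symmetric] exp_minus[symmetric]) simp
    moreover have "exp (Suc m * t) \<noteq> 1" using that by simp
    ultimately show ?thesis by (simp only: a_def) (simp add: field_simps)
  qed
  have squares: "(\<lambda>m. 1 / (real (Suc m) * real (Suc m))) sums (pi\<^sup>2 / 6)"
    using inverse_squares_sums by (simp add: power2_eq_square algebra_simps)
  have ev: "\<forall>\<^sub>F t in at_right (0::real). t > 0" by (rule eventually_at_right_less)
  have "((\<lambda>t. suminf (\<lambda>m. a m t)) \<longlongrightarrow> (\<Sum>m. 1 / (real (Suc m) * real (Suc m)))) (at_right 0)"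
  proof (rule tannerys_theorem[THEN conjunct2, THEN conjunct2])
    fix m :: nat
    have "((\<lambda>t. t / (c * (exp (c * t) - 1))) \<longlongrightarrow> 1 / (c * c)) (at_right 0)" if "c > 0" for c :: real
      using that by (real_asymp simp: field_simps)
    from this[of "Suc m"]
    have "((\<lambda>t::real. t / (Suc m * (exp (Suc m * t) - 1))) \<longlongrightarrow> 1 / (real (Suc m) * real (Suc m))) (at_right 0)"
      by simp
    then show "((\<lambda>t. a m t) \<longlongrightarrow> 1 / (real (Suc m) * real (Suc m))) (at_right 0)"
      by (rule Lim_transform_eventually) (rule eventually_mono[OF ev], simp only: a_eq)
  next
    have "norm (a m t) \<le> 1 / (real (Suc m) * real (Suc m))" if "t > 0" for m and t :: real
    proof -
      have e: "Suc m * t \<le> exp (Suc m * t) - 1" using exp_ge_add_one_self[of "Suc m * t"] by linarith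
      moreover have p: "0 < Suc m * t" using that by simp
      ultimately have "a m t \<le> t / (Suc m * (Suc m * t))"
        unfolding a_eq[OF that] using that by (intro divide_left_mono mult_left_mono mult_pos_pos) auto
      also have "\<dots> = 1 / (real (Suc m) * real (Suc m))" using that by simp
      finally show ?thesis using e p that by (simp add: a_eq)
    qed
    then show "\<forall>\<^sub>F (m, t) in sequentially \<times>\<^sub>F at_right 0. norm (a m t) \<le> 1 / (real (Suc m) * real (Suc m))"
      using eventually_prodI[OF eventually_True[of sequentially] ev]
      by (auto elim!: eventually_mono)
  qed (use squares in \<open>auto simp: sums_iff\<close>)
  moreover have "\<forall>\<^sub>F t in at_right 0. suminf (\<lambda>m. a m t) = t * log_euler t"
    using ev
  proof eventually_elim
    case (elim t)
    obtain S where S: "(\<lambda>k. - ln (1 - exp (- t) ^ Suc k)) sums S"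
      "(\<lambda>m. exp (- t) ^ Suc m / (Suc m * (1 - exp (- t) ^ Suc m))) sums S"
      by (rule lambert_double_series[of "exp (- t)"]) (use elim in auto)
    have "S = log_euler t" using S(1) log_euler_sums[OF elim] sums_unique2 by blast
    then show ?case using sums_mult[OF S(2), of t] by (simp only: a_def sums_iff)
  qed
  ultimately have "((\<lambda>t. t * log_euler t) \<longlongrightarrow> (\<Sum>m. 1 / (real (Suc m) * real (Suc m)))) (at_right 0)"
    by (rule Lim_transform_eventually)
  then show ?thesis using squares by (simp only: sums_iff)
qed

lemma log_euler_scaled_at_0:
  fixes c :: real
  assumes "c > 0"
  shows "((\<lambda>t. t * log_euler (c * t)) \<longlongrightarrow> pi\<^sup>2 / (6 * c)) (at_right 0)"
proof -
  have "filterlim (\<lambda>t. c * t) (at_right 0) (at_right 0)"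
    using assms by real_asymp
  from tendsto_divide[OF filterlim_compose[OF log_euler_at_0 this] tendsto_const[of c]]
  show ?thesis using assms by (simp add: mult.assoc mult.commute)
qed

lemma exp_double_power: "exp (- (2 * t)) ^ n = exp (- (t::real)) ^ (2 * n)"
proof -
  have "exp (- (2 * t)) = exp (- t) ^ 2" by (simp flip: exp_double)
  then show ?thesis by (simp add: power_mult)
qed

lemma even_log_euler_sums:
  fixes t :: real
  assumes "t > 0"
  shows "(\<lambda>k. - ln (1 - exp (- t) ^ (2 * Suc k))) sums log_euler (2 * t)"
  using log_euler_sums[of "2 * t"] assms by (simp only: exp_double_power)

lemma ln_one_plus:
  assumes "0 \<le> x" "x < (1::real)" 
  shows "ln (1 + x) = - ln (1 - x) - (- ln (1 - x\<^sup>2))"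
proof -
  have "1 - x\<^sup>2 = (1 - x) * (1 + x)" by (simp add: algebra_simps power2_eq_square)
  then show ?thesis using assms by (simp add: ln_mult)
qed

lemma ln_one_plus_exp:
  fixes t :: real
  assumes "t > 0" 
  shows "ln (1 + exp (- t) ^ Suc k) = - ln (1 - exp (- t) ^ Suc k) - (- ln (1 - exp (- (2 * t)) ^ Suc k))"
proof -
  have "exp (- t) ^ Suc k < 1" using assms by (simp add: power_less_one_iff del: power_Suc)
  moreover have "exp (- (2 * t)) ^ Suc k = (exp (- t) ^ Suc k)\<^sup>2"
    by (simp only: exp_double_power power_mult[symmetric] mult.commute[of _ "2::nat"])
  ultimately show ?thesis using ln_one_plus[of "exp (- t) ^ Suc k"] by simp
qed

text \<open>
  Since \<open>1 + y = (1 - y\<^sup>2) / (1 - y)\<close>, the logarithm of a product of factors \<open>1 + x ^ m\<close> is the difference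
  of two logarithms of products of factors \<open>1 - x ^ m\<close>, one at \<open>x\<close> and one at \<open>x\<^sup>2\<close>.
\<close>

lemma log_distinct_sums:
  fixes t :: real
  assumes "t > 0"
  shows "(\<lambda>k. ln (1 + exp (- t) ^ Suc k)) sums (log_euler t - log_euler (2 * t))"
  unfolding ln_one_plus_exp[OF assms]
  using assms by (intro sums_diff log_euler_sums) auto

text \<open>
  The sum over all exponents minus the sum over the even ones.
\<close>

lemma odd_log_euler_sums:
  fixes t :: real
  assumes "t > 0"
  shows "(\<lambda>k. - ln (1 - exp (- t) ^ Suc (2 * k))) sums (log_euler t - log_euler (2 * t))"
proof -
  have "(\<lambda>k. (\<Sum>i\<in>{k * 2..<k * 2 + 2}. - ln (1 - exp (- t) ^ Suc i))) sums log_euler t"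
    by (intro sums_group log_euler_sums assms) simp
  from sums_diff[OF this even_log_euler_sums[OF assms]] show ?thesis
    by (simp add: numeral_2_eq_2 mult.commute)
qed

lemma log_odd_distinct_sums:
  fixes t :: real
  assumes "t > 0"
  shows "(\<lambda>k. ln (1 + exp (- t) ^ Suc (2 * k))) sums
    ((log_euler t - log_euler (2 * t)) - (log_euler (2 * t) - log_euler (4 * t)))"
  unfolding ln_one_plus_exp[OF assms]
  using assms odd_log_euler_sums[of "2 * t"] by (intro sums_diff odd_log_euler_sums) auto

section \<open>Infinite products of power series with nonnegative coefficients\<close>

text \<open>
  The value at \<open>x\<close> of a series with nonnegative coefficients is recorded through its logarithm, so that
  products of series become sums and infinite products become series.
\<close>

definition log_value :: "real fps \<Rightarrow> real \<Rightarrow> real \<Rightarrow> bool" where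
  "log_value F x a \<longleftrightarrow> (\<forall>n. 0 \<le> fps_nth F n) \<and> (\<lambda>n. fps_nth F n * x ^ n) sums exp a"

lemma log_value_nonneg: "log_value F x a \<Longrightarrow> 0 \<le> fps_nth F n"
  by (simp add: log_value_def)

lemma log_value_1: "log_value 1 x 0"
proof -
  have "(\<lambda>n. fps_nth 1 n * x ^ n) = (\<lambda>n. if n = 0 then 1 else 0)" by auto
  then show ?thesis using sums_single[of 0 "\<lambda>_. 1 :: real"] by (simp add: log_value_def)
qed

lemma log_value_mult:
  assumes F: "log_value F x a" and G: "log_value G x b" and "0 \<le> x"
  shows "log_value (F * G) x (a + b)"
proof -
  let ?f = "\<lambda>n. fps_nth F n * x ^ n" and ?g = "\<lambda>n. fps_nth G n * x ^ n"
  have "norm (?f n) = ?f n" "norm (?g n) = ?g n" for n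
    using assms by (auto simp: log_value_def)
  then have "(\<lambda>k. \<Sum>i\<le>k. ?f i * ?g (k - i)) sums (suminf ?f * suminf ?g)"
    using assms by (intro Cauchy_product_sums) (auto simp: log_value_def sums_iff)
  moreover have "(\<Sum>i\<le>k. ?f i * ?g (k - i)) = fps_nth (F * G) k * x ^ k" for k
  proof -
    have "?f i * ?g (k - i) = fps_nth F i * fps_nth G (k - i) * x ^ k" if "i \<le> k" for i
    proof -
      have "x ^ k = x ^ i * x ^ (k - i)" using that by (simp flip: power_add)
      then show ?thesis by simp
    qed
    then show ?thesis
      unfolding fps_mult_nth sum_distrib_right atLeast0AtMost by (intro sum.cong) simp_all
  qed
  moreover have "suminf ?f * suminf ?g = exp (a + b)"
    using F G by (simp add: log_value_def sums_iff exp_add)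
  ultimately show ?thesis
    using F G by (auto simp: log_value_def fps_mult_nth intro!: sum_nonneg)
qed

lemma log_value_power: "log_value F x a \<Longrightarrow> 0 \<le> x \<Longrightarrow> log_value (F ^ n) x (n * a)"
  by (induction n) (auto simp: log_value_1 algebra_simps intro: log_value_mult)

lemma log_value_prod:
  "(\<And>k. log_value (h k) x (l k)) \<Longrightarrow> 0 \<le> x \<Longrightarrow> log_value (\<Prod>k\<le>(N::nat). h k) x (\<Sum>k\<le>N. l k)"
  by (induction N) (auto intro: log_value_mult)

lemma log_value_one_plus:
  assumes "m > 0" "0 \<le> x"
  shows "log_value (1 + fps_X ^ m) x (ln (1 + x ^ m))"
proof -
  have "(\<lambda>n. (if n = 0 then 1 else 0) + (if n = m then x ^ m else 0)) sums (1 + x ^ m)"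
    by (intro sums_add sums_single)
  moreover have "fps_nth (1 + fps_X ^ m) n * x ^ n = (if n = 0 then 1 else 0) + (if n = m then x ^ m else 0)" for n
    using assms by (simp add: fps_X_power_nth)
  moreover have "0 < 1 + x ^ m" using assms by (simp add: add_pos_nonneg)
  ultimately show ?thesis by (simp add: log_value_def fps_X_power_nth)
qed

text \<open>
  The explicit coefficients make nonnegativity visible and reduce the evaluation to a geometric series.
\<close>

lemma geometric_fps:
  assumes "m > 0"
  shows "1 / (1 - fps_X ^ m :: real fps) = Abs_fps (\<lambda>n. if m dvd n then 1 else 0)"
proof -
  let ?G = "Abs_fps (\<lambda>n. if m dvd n then 1 else 0) :: real fps"
  have "?G * (1 - fps_X ^ m) = 1"
    using assms by (auto simp: fps_eq_iff algebra_simps fps_X_power_mult_nth dvd_minus_self elim: dvdE)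
  moreover have "1 - fps_X ^ m \<noteq> (0 :: real fps)" using \<open>?G * _ = 1\<close> by (metis mult_zero_right zero_neq_one)
  ultimately show ?thesis by (metis nonzero_mult_div_cancel_right)
qed

lemma log_value_geometric:
  assumes "m > 0" "0 \<le> x" "x < 1"
  shows "log_value (1 / (1 - fps_X ^ m)) x (- ln (1 - x ^ m))"
proof -
  have lt: "x ^ m < 1" using assms by (simp add: power_less_one_iff)
  have "(\<lambda>k. (x ^ m) ^ k) sums (1 / (1 - x ^ m))"
    using lt assms by (intro geometric_sums) simp
  also have "(\<lambda>k. (x ^ m) ^ k) = (\<lambda>k. (\<lambda>n. (if m dvd n then 1 else 0) * x ^ n) (m * k))"
    by (simp add: power_mult)
  also have "\<dots> sums (1 / (1 - x ^ m)) \<longleftrightarrow> (\<lambda>n. (if m dvd n then 1 else 0) * x ^ n) sums (1 / (1 - x ^ m))"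
    using assms by (intro sums_mono_reindex) (auto simp: strict_mono_def elim!: dvdE)
  finally show ?thesis using lt assms
    by (simp add: log_value_def geometric_fps exp_minus inverse_eq_divide)
qed

lemma fps_nth_prod_stable:
  fixes h :: "nat \<Rightarrow> real fps"
  assumes "\<And>k. one_mod_X (Suc k) (h k)" "n \<le> N"
  shows "fps_nth (\<Prod>k\<le>N. h k) n = fps_nth (\<Prod>k\<le>n. h k) n"
  using has_prod_one_mod_X(2)[of h] assms by (metis order_refl)

text \<open>
  The coefficients of the partial products increase to those of the infinite product, as every factor is 1
  plus a series with nonnegative coefficients. Hence each partial product is dominated at \<open>x\<close> by the
  limit series, and a partial sum of the limit series up to \<open>N\<close> is dominated by the value of the \<open>N\<close>-th
  partial product. Both bounds converge to \<open>exp s\<close>.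
\<close>

lemma sums_infinite_product:
  assumes one: "\<And>k. one_mod_X (Suc k) (h k)"
    and val: "\<And>k. log_value (h k) x (l k)" and l: "l sums s" and x: "0 \<le> x"
  shows "(\<lambda>n. fps_nth (\<Prod>k\<le>n. h k) n * x ^ n) sums exp s"
proof -
  define P where "P N = (\<Prod>k\<le>N. h k)" for N
  have lv: "log_value (P N) x (\<Sum>k\<le>N. l k)" for N
    unfolding P_def using val x by (rule log_value_prod)
  have P_nonneg: "0 \<le> fps_nth (P N) n" for n N using lv by (rule log_value_nonneg)
  have h0: "fps_nth (h k) 0 = 1" for k using one one_mod_X_nth0 by blast
  have stable: "fps_nth (P N) n = fps_nth (P n) n" if "n \<le> N" for n N
    unfolding P_def using one that by (rule fps_nth_prod_stable)
  have step: "fps_nth (P N) n \<le> fps_nth (P (Suc N)) n" for n N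
  proof -
    have "fps_nth (P N) n * fps_nth (h (Suc N)) (n - n) \<le> (\<Sum>i=0..n. fps_nth (P N) i * fps_nth (h (Suc N)) (n - i))"
      using P_nonneg log_value_nonneg[OF val] by (intro member_le_sum) auto
    then show ?thesis by (simp add: P_def fps_mult_nth h0)
  qed
  have le_diag: "fps_nth (P N) n \<le> fps_nth (P n) n" for n N
  proof (cases "n \<le> N")
    case False
    then have "N \<le> n" by simp
    then show ?thesis by (rule lift_Suc_mono_le[of "\<lambda>N. fps_nth (P N) n", OF step])
  qed (simp add: stable[of n N])
  have lpos: "0 \<le> l k" for k
  proof -
    have lk: "summable (\<lambda>n. fps_nth (h k) n * x ^ n)" "(\<Sum>n. fps_nth (h k) n * x ^ n) = exp (l k)"
      "0 \<le> fps_nth (h k) n * x ^ n" for n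
      using val[of k] x by (simp_all add: log_value_def sums_iff)
    have "(\<Sum>n\<in>{0}. fps_nth (h k) n * x ^ n) \<le> (\<Sum>n. fps_nth (h k) n * x ^ n)"
      by (rule sum_le_suminf) (use lk in auto)
    then have "1 \<le> exp (l k)" by (simp add: lk(2) h0)
    then show ?thesis by simp
  qed
  have exp_le: "exp (\<Sum>k\<le>N. l k) \<le> exp s" for N
    using l lpos sum_le_suminf[of l "{..N}"] by (simp add: sums_iff)
  have bound: "(\<Sum>n<N. fps_nth (P n) n * x ^ n) \<le> exp s" for N
  proof -
    have "(\<Sum>n<N. fps_nth (P n) n * x ^ n) = (\<Sum>n<N. fps_nth (P N) n * x ^ n)"
      by (intro sum.cong refl) (simp add: stable[of _ N, symmetric])
    also have "\<dots> \<le> (\<Sum>n. fps_nth (P N) n * x ^ n)"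
      using lv[of N] x by (intro sum_le_suminf) (auto simp: log_value_def sums_iff)
    also have "\<dots> = exp (\<Sum>k\<le>N. l k)" using lv[of N] by (simp add: log_value_def sums_iff)
    also note exp_le
    finally show ?thesis .
  qed
  have summable: "summable (\<lambda>n. fps_nth (P n) n * x ^ n)"
    using bound P_nonneg x by (intro summableI_nonneg_bounded[where x = "exp s"]) auto
  have "exp (\<Sum>k\<le>N. l k) \<le> (\<Sum>n. fps_nth (P n) n * x ^ n)" for N
    using lv[of N] summable x unfolding log_value_def sums_iff
    by (metis (no_types, lifting) le_diag mult_right_mono suminf_le zero_le_power)
  moreover have "(\<lambda>N. exp (\<Sum>k\<le>N. l k)) \<longlonglongrightarrow> exp s"
    using l by (intro tendsto_exp) (simp add: sums_def_le)
  ultimately have "exp s \<le> (\<Sum>n. fps_nth (P n) n * x ^ n)"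
    by (intro LIMSEQ_le_const2) auto
  moreover have "(\<Sum>n. fps_nth (P n) n * x ^ n) \<le> exp s"
    using summable bound by (rule suminf_le_const)
  ultimately show ?thesis
    using summable by (simp add: sums_iff P_def)
qed

lemma nonneg_mult_fps:
  fixes F G :: "real fps"
  assumes "\<And>n. 0 \<le> fps_nth F n" "\<And>n. 0 \<le> fps_nth G n"
  shows "0 \<le> fps_nth (F * G) n"
  using assms by (auto simp: fps_mult_nth intro!: sum_nonneg)

text \<open>
  The differences of consecutive coefficients are the coefficients of \<open>1 - X\<close> times the product, and the
  factor \<open>h 0\<close> absorbs \<open>1 - X\<close>.
\<close>

lemma mono_infinite_product:
  fixes h :: "nat \<Rightarrow> real fps"
  assumes one: "\<And>k. one_mod_X (Suc k) (h k)" and nonneg: "\<And>k n. 0 \<le> fps_nth (h k) n"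
    and h0: "\<And>n. 0 \<le> fps_nth ((1 - fps_X) * h 0) n"
  shows "mono (\<lambda>n. fps_nth (\<Prod>k\<le>n. h k) n)"
proof (rule monoI, rule lift_Suc_mono_le)
  fix n
  have nn: "0 \<le> fps_nth ((1 - fps_X) * (\<Prod>k\<le>N. h k)) m" for N m
  proof (induction N arbitrary: m)
    case (Suc N)
    then have "0 \<le> fps_nth ((1 - fps_X) * (\<Prod>k\<le>N. h k) * h (Suc N)) m"
      using nonneg by (intro nonneg_mult_fps[of "(1 - fps_X) * (\<Prod>k\<le>N. h k)"]) auto
    then show ?case by (simp add: mult.assoc)
  qed (use h0 in simp)
  have "0 \<le> fps_nth (\<Prod>k\<le>Suc n. h k) (Suc n) - fps_nth (\<Prod>k\<le>Suc n. h k) n"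
    using nn[of "Suc n" "Suc n"] by (simp only: left_diff_distrib mult_1_left fps_sub_nth fps_X_mult_nth) simp
  then show "fps_nth (\<Prod>k\<le>n. h k) n \<le> fps_nth (\<Prod>k\<le>Suc n. h k) (Suc n)"
    using fps_nth_prod_stable[of h n "Suc n", OF one] by simp
qed

text \<open>
  The form in which the Tauberian theorem is applied: all its hypotheses are read off from the factors.
\<close>

theorem infinite_product_asymptotics:
  fixes h :: "nat \<Rightarrow> real fps" and l :: "real \<Rightarrow> nat \<Rightarrow> real" and s :: "real \<Rightarrow> real"
  assumes one: "\<And>k. one_mod_X (Suc k) (h k)"
    and h0: "\<And>n. 0 \<le> fps_nth ((1 - fps_X) * h 0) n"
    and val: "\<And>t k. t > 0 \<Longrightarrow> log_value (h k) (exp (- t)) (l t k)"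
    and sums: "\<And>t. t > 0 \<Longrightarrow> l t sums s t"
    and lim: "((\<lambda>t. t * s t) \<longlongrightarrow> C) (at_right 0)" and C: "C > 0"
  defines "u \<equiv> \<lambda>n. fps_nth (\<Prod>k\<le>n. h k) n"
  shows "\<forall>\<^sub>F n in sequentially. u n > 0"
    and "(\<lambda>n. ln (u n)) \<sim>[sequentially] (\<lambda>n. 2 * sqrt (C * n))"
proof -
  have h_nonneg: "0 \<le> fps_nth (h k) n" for k n
    using val[of 1 k] log_value_nonneg by simp
  have "0 \<le> u n" for n
    unfolding u_def using log_value_nonneg[OF log_value_prod[of h "exp (- 1)" "l 1"]] val[of 1] by simp
  moreover have "mono u"
    unfolding u_def using one h_nonneg h0 by (rule mono_infinite_product)
  moreover have "(\<lambda>n. u n * exp (- t) ^ n) sums exp (s t)" if "t > 0" for t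
    unfolding u_def using one val[OF that] sums[OF that] by (rule sums_infinite_product) simp
  ultimately show "\<forall>\<^sub>F n in sequentially. u n > 0"
    and "(\<lambda>n. ln (u n)) \<sim>[sequentially] (\<lambda>n. 2 * sqrt (C * n))"
    using tauberian_sqrt_growth[of u s C] lim C by blast+
qed

section \<open>Coefficient growth of partition products\<close>

lemma fps_one_over_power:
  fixes y :: "real fps"
  assumes "fps_nth y 0 \<noteq> 0"
  shows "1 / y ^ n = (1 / y) ^ n"
  using assms by (simp add: fps_divide_unit fps_inverse_power fps_nth_power_0)

lemma one_over_mult_cancel:
  fixes y :: "real fps"
  assumes "fps_nth y 0 \<noteq> 0"
  shows "y * (1 / y) = 1"
  using assms by (simp add: fps_divide_unit inverse_mult_eq_1')

lemma one_mod_X_geometric: "m \<le> n \<Longrightarrow> m > 0 \<Longrightarrow> one_mod_X m (1 / (1 - fps_X ^ n))"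
  by (intro one_mod_X_div) (auto simp: one_mod_X_def intro!: exI[of _ "- (fps_X ^ (n - m))"] simp flip: power_add)

lemma one_mod_X_one_plus: "m \<le> n \<Longrightarrow> one_mod_X m (1 + fps_X ^ n)"
  by (auto simp: one_mod_X_def intro!: exI[of _ "fps_X ^ (n - m)"] simp flip: power_add)

lemma one_mod_X_one_minus: "m \<le> n \<Longrightarrow> one_mod_X m (1 - fps_X ^ n)"
  by (auto simp: one_mod_X_def intro!: exI[of _ "- (fps_X ^ (n - m))"] simp flip: power_add)

lemma partition_power_asymptotics:
  fixes d :: nat
  assumes "d > 0"
  defines "u \<equiv> \<lambda>n. fps_nth (\<Prod>k\<le>n. (1 / (1 - fps_X ^ Suc k)) ^ d) n :: real"
  shows "\<forall>\<^sub>F n in sequentially. u n > 0"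
    and "(\<lambda>n. ln (u n)) \<sim>[sequentially] (\<lambda>n. 2 * sqrt (d * (pi\<^sup>2 / 6) * n))"
proof -
  let ?h = "\<lambda>k. (1 / (1 - fps_X ^ Suc k)) ^ d :: real fps"
  have one: "one_mod_X (Suc k) (?h k)" for k
    by (intro one_mod_X_power one_mod_X_geometric) auto
  have h0: "0 \<le> fps_nth ((1 - fps_X) * ?h 0) n" for n
  proof -
    obtain d' where d: "d = Suc d'" using assms(1) gr0_conv_Suc by blast
    have "(1 - fps_X) * ?h 0 = ((1 - fps_X) * (1 / (1 - fps_X))) * (1 / (1 - fps_X ^ 1)) ^ d'"
      unfolding d power_Suc by (simp only: mult.assoc power_one_right power_0 mult_1_right)
    also have "\<dots> = (1 / (1 - fps_X ^ 1)) ^ d'"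
      by (subst one_over_mult_cancel) auto
    finally show ?thesis
      using log_value_nonneg[OF log_value_power[OF log_value_geometric[of 1 0]]] by simp
  qed
  have val: "log_value (?h k) (exp (- t)) (d * - ln (1 - exp (- t) ^ Suc k))" if "t > 0" for t k
    using that by (intro log_value_power log_value_geometric) auto
  have sums: "(\<lambda>k. d * - ln (1 - exp (- t) ^ Suc k)) sums (d * log_euler t)" if "t > 0" for t
    using that by (intro sums_mult log_euler_sums)
  have lim: "((\<lambda>t. t * (d * log_euler t)) \<longlongrightarrow> d * (pi\<^sup>2 / 6)) (at_right 0)"
    using tendsto_mult[OF tendsto_const[of "real d"] log_euler_at_0] by (simp only: mult.left_commute)
  have C: "real d * (pi\<^sup>2 / 6) > 0" using assms(1) by simp
  show "\<forall>\<^sub>F n in sequentially. u n > 0"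
    unfolding u_def by (rule infinite_product_asymptotics(1)[OF one h0 val sums lim C])
  show "(\<lambda>n. ln (u n)) \<sim>[sequentially] (\<lambda>n. 2 * sqrt (d * (pi\<^sup>2 / 6) * n))"
    unfolding u_def by (rule infinite_product_asymptotics(2)[OF one h0 val sums lim C])
qed

text \<open>
  Both signs of the Euler characteristic lead to a product of this form, with \<open>e k = k + 1\<close> or
  \<open>e k = 2 * k + 1\<close>. The coefficients increase because the first factor contains
  \<open>(1 + X)\<^sup>2 / (1 - X\<^sup>2) = (1 + X) / (1 - X)\<close>; this is where \<open>a \<ge> 2\<close> and \<open>b \<ge> 1\<close> enter.
\<close>

lemma distinct_partition_asymptotics:
  fixes a b :: nat and e :: "nat \<Rightarrow> nat" and D :: "real \<Rightarrow> real" and \<delta> :: real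
  assumes a: "a \<ge> 2" and b: "b \<ge> 1" and e: "e 0 = 1" "\<And>k. Suc k \<le> e k"
    and D: "\<And>t. t > 0 \<Longrightarrow> (\<lambda>k. ln (1 + exp (- t) ^ e k)) sums D t"
    and D_lim: "((\<lambda>t. t * D t) \<longlongrightarrow> \<delta>) (at_right 0)" and \<delta>: "\<delta> > 0"
  defines "u \<equiv> \<lambda>n. fps_nth (\<Prod>k\<le>n. (1 + fps_X ^ e k) ^ a * (1 / (1 - fps_X ^ (2 * Suc k))) ^ b) n :: real"
  shows "\<forall>\<^sub>F n in sequentially. u n > 0"
    and "(\<lambda>n. ln (u n)) \<sim>[sequentially] (\<lambda>n. 2 * sqrt ((a * \<delta> + b * (pi\<^sup>2 / 12)) * n))"
proof -
  let ?h = "\<lambda>k. (1 + fps_X ^ e k) ^ a * (1 / (1 - fps_X ^ (2 * Suc k))) ^ b :: real fps"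
  have one: "one_mod_X (Suc k) (?h k)" for k
    using e by (intro one_mod_X_mult one_mod_X_power one_mod_X_geometric one_mod_X_one_plus) auto
  have h0: "0 \<le> fps_nth ((1 - fps_X) * ?h 0) n" for n
  proof -
    obtain a' where a': "a = Suc a'" using a by (cases a) auto
    obtain b' where b': "b = Suc b'" using b by (cases b) auto
    have "(1 - fps_X) * ?h 0 = ((1 - fps_X ^ 2) * (1 / (1 - fps_X ^ 2))) * ((1 + fps_X ^ 1) ^ a' * (1 / (1 - fps_X ^ 2)) ^ b')"
      unfolding a' b' e power_Suc by (simp add: algebra_simps power2_eq_square)
    also have "\<dots> = (1 + fps_X ^ 1) ^ a' * (1 / (1 - fps_X ^ 2)) ^ b'"
      by (subst one_over_mult_cancel) auto
    finally show ?thesis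
      using log_value_nonneg[OF log_value_mult[OF log_value_power[OF log_value_one_plus[of 1 0]]
            log_value_power[OF log_value_geometric[of 2 0]]]] by simp
  qed
  have val: "log_value (?h k) (exp (- t)) (a * ln (1 + exp (- t) ^ e k) + b * - ln (1 - exp (- t) ^ (2 * Suc k)))"
    if "t > 0" for t k
  proof -
    have "e k > 0" using e(2)[of k] by simp
    then show ?thesis using that
      by (intro log_value_mult log_value_power log_value_geometric log_value_one_plus) auto
  qed
  have sums: "(\<lambda>k. a * ln (1 + exp (- t) ^ e k) + b * - ln (1 - exp (- t) ^ (2 * Suc k)))
      sums (a * D t + b * log_euler (2 * t))" if "t > 0" for t
    using that by (intro sums_add sums_mult D even_log_euler_sums)
  have "((\<lambda>t. a * (t * D t) + b * (t * log_euler (2 * t))) \<longlongrightarrow> a * \<delta> + b * (pi\<^sup>2 / (6 * 2))) (at_right 0)"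
    by (intro tendsto_add tendsto_mult_left D_lim log_euler_scaled_at_0) simp
  then have lim: "((\<lambda>t. t * (a * D t + b * log_euler (2 * t))) \<longlongrightarrow> a * \<delta> + b * (pi\<^sup>2 / 12)) (at_right 0)"
    by (simp add: algebra_simps)
  have C: "a * \<delta> + b * (pi\<^sup>2 / 12) > 0" using a b \<delta> by (simp add: add_pos_nonneg)
  show "\<forall>\<^sub>F n in sequentially. u n > 0"
    unfolding u_def by (rule infinite_product_asymptotics(1)[OF one h0 val sums lim C])
  show "(\<lambda>n. ln (u n)) \<sim>[sequentially] (\<lambda>n. 2 * sqrt ((a * \<delta> + b * (pi\<^sup>2 / 12)) * n))"
    unfolding u_def by (rule infinite_product_asymptotics(2)[OF one h0 val sums lim C])
qed

section \<open>The counting sequences as coefficients of nonnegative products\<close>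

lemma odd_times_distinct_telescope:
  "(\<Prod>k\<le>N. (1 - fps_X ^ Suc (2 * k)) * (1 + fps_X ^ Suc k)) * (\<Prod>k\<le>N. 1 - fps_X ^ Suc k)
    = (\<Prod>k\<le>Suc (2 * N). 1 - fps_X ^ Suc k :: real fps)"
proof (induction N)
  case 0
  show ?case by (simp add: algebra_simps power2_eq_square)
next
  case (Suc N)
  have diff_squares: "(1 + y) * (1 - y) = 1 - y * y" for y :: "real fps"
    by (simp add: algebra_simps)
  have square: "(1 + fps_X ^ n) * (1 - fps_X ^ n) = (1 - fps_X ^ (2 * n) :: real fps)" for n
    by (simp only: diff_squares mult_2 power_add)
  have idx: "Suc (2 * Suc N) = Suc (Suc (Suc (2 * N)))" "2 * Suc (Suc N) = Suc (Suc (Suc (Suc (2 * N))))"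
    by simp_all
  have "(\<Prod>k\<le>Suc N. (1 - fps_X ^ Suc (2 * k)) * (1 + fps_X ^ Suc k)) * (\<Prod>k\<le>Suc N. 1 - fps_X ^ Suc k)
      = ((\<Prod>k\<le>N. (1 - fps_X ^ Suc (2 * k)) * (1 + fps_X ^ Suc k)) * (\<Prod>k\<le>N. 1 - fps_X ^ Suc k))
        * (1 - fps_X ^ Suc (2 * Suc N)) * ((1 + fps_X ^ Suc (Suc N)) * (1 - fps_X ^ Suc (Suc N)) :: real fps)"
    by (simp only: prod.atMost_Suc mult_ac)
  also have "\<dots> = (\<Prod>k\<le>Suc (2 * N). 1 - fps_X ^ Suc k)
        * (1 - fps_X ^ Suc (2 * Suc N)) * (1 - fps_X ^ (2 * Suc (Suc N)))"
    by (simp only: Suc.IH square)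
  also have "\<dots> = (\<Prod>k\<le>Suc (2 * Suc N). 1 - fps_X ^ Suc k)"
    by (simp only: idx prod.atMost_Suc)
  finally show ?case .
qed

text \<open>
  A truncated form of Euler's identity between partitions into odd parts and partitions into distinct parts.
  By the telescoping identity, the product on the left is the product of the factors \<open>1 - X ^ m\<close> with
  \<open>N + 2 \<le> m \<le> 2 * N + 2\<close>, all of which are 1 up to degree \<open>N\<close>.
\<close>

lemma euler_odd_distinct:
  "one_mod_X (Suc N) (\<Prod>k\<le>N. (1 - fps_X ^ Suc (2 * k)) * (1 + fps_X ^ Suc k))"
proof -
  let ?Q = "\<Prod>k\<le>N. 1 - fps_X ^ Suc k :: real fps" and ?R = "\<Prod>k\<in>{Suc N..Suc (2 * N)}. 1 - fps_X ^ Suc k :: real fps"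
  have "{..Suc (2 * N)} = {..N} \<union> {Suc N..Suc (2 * N)}" by auto
  then have "(\<Prod>k\<le>Suc (2 * N). 1 - fps_X ^ Suc k :: real fps) = ?Q * ?R"
    by (simp only:) (rule prod.union_disjoint, auto)
  then have "(\<Prod>k\<le>N. (1 - fps_X ^ Suc (2 * k)) * (1 + fps_X ^ Suc k)) * ?Q = ?R * ?Q"
    using odd_times_distinct_telescope[of N] by (simp only: mult.commute)
  moreover have one: "one_mod_X m (\<Prod>k\<in>A. 1 - fps_X ^ Suc k)" if "\<And>k. k \<in> A \<Longrightarrow> m \<le> Suc k" for A m
    using that by (induction A rule: infinite_finite_induct)
      (auto intro!: one_mod_X_mult one_mod_X_one_minus one_mod_X_1 simp del: power_Suc)
  have "fps_nth ?Q 0 = 1" by (rule one_mod_X_nth0[of 1, OF _ one]) auto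
  then have "?Q \<noteq> 0" by (metis fps_zero_nth zero_neq_one)
  moreover have "one_mod_X (Suc N) ?R" by (rule one) auto
  ultimately show ?thesis by (simp only: mult_cancel_right simp_thms)
qed

lemma complex_count_eq: "complex_count n = fps_nth (\<Prod>k\<le>n. (1 / (1 - fps_X ^ Suc k)) ^ 24) n"
proof -
  have "complex_count n = fps_nth (\<Prod>k\<le>n. 1 / (1 - fps_X ^ Suc k) powi e_C) n"
    unfolding complex_count_def complex_count_gf_def
    by (rule has_prod_one_mod_X(2)[OF one_mod_X_complex order_refl])
  also have "(\<lambda>k. 1 / (1 - fps_X ^ Suc k) powi e_C) = (\<lambda>k. (1 / (1 - fps_X ^ Suc k :: real fps)) ^ 24)"
    by (subst fps_one_over_power[symmetric]) (auto simp: power_int_numeral)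
  finally show ?thesis .
qed

text \<open>
  Turns the coefficients of a product of two infinite products into coefficients of finite products, on which
  all further identities are purely algebraic.
\<close>

lemma fps_nth_mult_prodinf:
  fixes f g :: "nat \<Rightarrow> real fps"
  assumes "\<And>k. one_mod_X (Suc k) (f k)" "\<And>k. one_mod_X (Suc k) (g k)"
  shows "fps_nth (prodinf f * prodinf g) n = fps_nth (\<Prod>k\<le>n. f k * g k) n"
proof -
  have "fps_nth (prodinf f) i = fps_nth (\<Prod>k\<le>n. f k) i" "fps_nth (prodinf g) i = fps_nth (\<Prod>k\<le>n. g k) i"
    if "i \<le> n" for i
    using has_prod_one_mod_X(2)[of f] has_prod_one_mod_X(2)[of g] assms that by blast+
  then show ?thesis by (simp add: prod.distrib fps_mult_nth)
qed

lemma real_count_eq: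
  assumes "e_R \<le> 24"
  shows "real_count e_R n = fps_nth (\<Prod>k\<le>n. 1 / (1 + fps_X ^ Suc k) powi e_R
            * (1 / (1 - fps_X ^ (2 * Suc k))) ^ nat ((24 - e_R) div 2)) n"
proof -
  have "1 / (1 - fps_X ^ (2 * Suc k)) powi ((e_C - e_R) div 2)
      = (1 / (1 - fps_X ^ (2 * Suc k) :: real fps)) ^ nat ((24 - e_R) div 2)" for k
    using assms by (subst fps_one_over_power[symmetric]) (auto simp: power_int_def)
  then show ?thesis
    unfolding real_count_def real_count_gf_def
    by (subst fps_nth_mult_prodinf[OF one_mod_X_real_plus one_mod_X_real_minus]) simp
qed

lemma real_count_nonpos:
  assumes "e_R \<le> 0"
  shows "real_count e_R n = fps_nth (\<Prod>k\<le>n. (1 + fps_X ^ Suc k) ^ nat (- e_R)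
            * (1 / (1 - fps_X ^ (2 * Suc k))) ^ nat ((24 - e_R) div 2)) n"
proof -
  have "1 / (1 + fps_X ^ Suc k) powi e_R = (1 + fps_X ^ Suc k :: real fps) ^ nat (- e_R)" for k
  proof (cases "e_R = 0")
    case False
    then have "1 / (1 + fps_X ^ Suc k) powi e_R = 1 / inverse ((1 + fps_X ^ Suc k :: real fps) ^ nat (- e_R))"
      using assms by (simp add: power_int_def fps_inverse_power)
    also have "\<dots> = inverse (inverse ((1 + fps_X ^ Suc k :: real fps) ^ nat (- e_R)))"
      by (subst fps_divide_unit) (auto simp: fps_nth_power_0)
    finally show ?thesis
      by (subst (asm) fps_inverse_idempotent) (auto simp: fps_nth_power_0)
  qed simp
  then show ?thesis using assms by (simp add: real_count_eq)
qed

text \<open>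
  For a positive Euler characteristic the factors \<open>1 / (1 + X ^ (k + 1)) ^ e_R\<close> have coefficients of both
  signs. Euler's identity turns them into \<open>(1 - X ^ (2 * k + 1)) ^ e_R\<close>, and as only odd exponents are
  left, the substitution of \<open>- X\<close> for \<open>X\<close> makes all coefficients nonnegative: the signs of the counts
  alternate.
\<close>

lemma real_count_pos:
  assumes "0 < e_R" "e_R \<le> 24"
  shows "(-1) ^ n * real_count e_R n = fps_nth (\<Prod>k\<le>n. (1 + fps_X ^ Suc (2 * k)) ^ nat e_R
            * (1 / (1 - fps_X ^ (2 * Suc k))) ^ nat ((24 - e_R) div 2)) n"
proof -
  let ?a = "nat e_R" and ?b = "nat ((24 - e_R) div 2)"
  let ?p = "\<lambda>k. 1 + fps_X ^ Suc k :: real fps" and ?o = "\<lambda>k. 1 - fps_X ^ Suc (2 * k) :: real fps"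
    and ?q = "\<lambda>k. 1 / (1 - fps_X ^ (2 * Suc k)) :: real fps"
  have "1 / ?p k powi e_R = (1 / ?p k) ^ ?a" for k
    using assms by (subst fps_one_over_power[symmetric]) (auto simp: power_int_def)
  then have "real_count e_R n = fps_nth (\<Prod>k\<le>n. (1 / ?p k) ^ ?a * ?q k ^ ?b) n"
    using assms(2) by (simp add: real_count_eq)
  \<comment> \<open>The extra factor is 1 up to degree \<open>n\<close> and does not change the coefficient.\<close>
  also have "\<dots> = fps_nth ((\<Prod>k\<le>n. (1 / ?p k) ^ ?a * ?q k ^ ?b) * (\<Prod>k\<le>n. ?o k * ?p k) ^ ?a) n"
    by (rule nth_mult_one_mod_X[symmetric, OF one_mod_X_power[OF euler_odd_distinct]]) simp
  also have "(\<Prod>k\<le>n. (1 / ?p k) ^ ?a * ?q k ^ ?b) * (\<Prod>k\<le>n. ?o k * ?p k) ^ ?a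
      = (\<Prod>k\<le>n. (?p k * (1 / ?p k)) ^ ?a * (?o k ^ ?a * ?q k ^ ?b))"
    unfolding prod_power_distrib prod.distrib[symmetric] power_mult_distrib by (simp only: mult_ac)
  also have "\<dots> = (\<Prod>k\<le>n. ?o k ^ ?a * ?q k ^ ?b)"
    by (subst one_over_mult_cancel) auto
  finally have "(-1) ^ n * real_count e_R n = fps_nth ((\<Prod>k\<le>n. ?o k ^ ?a * ?q k ^ ?b) oo (- fps_X)) n"
    by (simp only: fps_compose_uminus' fps_nth_Abs_fps)
  also have "(\<Prod>k\<le>n. ?o k ^ ?a * ?q k ^ ?b) oo (- fps_X)
      = (\<Prod>k\<le>n. (1 + fps_X ^ Suc (2 * k)) ^ ?a * ?q k ^ ?b)"
  proof -
    have X: "fps_nth (- fps_X :: real fps) 0 = 0" by simp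
    have pow: "fps_X ^ m oo (- fps_X) = (- fps_X :: real fps) ^ m" for m
      by (simp flip: fps_compose_power[OF X])
    have o: "?o k oo (- fps_X) = 1 + fps_X ^ Suc (2 * k)" for k
      by (simp only: fps_compose_sub_distrib pow fps_compose_1) simp
    have "?q k = inverse (1 - fps_X ^ (2 * Suc k))" for k
      by (simp add: fps_divide_unit)
    then have q: "?q k oo (- fps_X) = ?q k" for k
      by (simp only:) (subst fps_inverse_compose[OF X], simp, simp only: fps_compose_sub_distrib pow fps_compose_1, simp)
    show ?thesis
      by (simp only: fps_compose_prod_distrib[OF X] fps_compose_mult_distrib[OF X]
          fps_compose_power[OF X, symmetric] o q)
  qed
  finally show ?thesis .
qed

lemma fps_nth_compose_square:
  fixes F :: "real fps"
  shows "fps_nth (F oo fps_X\<^sup>2) (2 * n) = fps_nth F n"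
  by (simp add: fps_compose_nth fps_X_power_nth if_distrib cong: if_cong flip: power_mult)

text \<open>
  For Euler characteristic 0 only the factors in \<open>X\<^sup>2\<close> survive.
\<close>

lemma real_count_zero:
  "real_count 0 (2 * n) = fps_nth (\<Prod>k\<le>n. (1 / (1 - fps_X ^ Suc k)) ^ 12) n"
proof -
  let ?q = "\<lambda>k. 1 / (1 - fps_X ^ Suc k) :: real fps"
  have X: "fps_nth (fps_X\<^sup>2 :: real fps) 0 = 0" by simp
  have pow: "fps_X ^ m oo fps_X\<^sup>2 = (fps_X ^ (2 * m) :: real fps)" for m
    by (simp flip: fps_compose_power[OF X] add: power_mult)
  have "?q k = inverse (1 - fps_X ^ Suc k)" for k by (simp add: fps_divide_unit)
  moreover have "1 / (1 - fps_X ^ (2 * Suc k)) = inverse (1 - fps_X ^ (2 * Suc k) :: real fps)" for k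
    by (simp add: fps_divide_unit)
  ultimately have q: "?q k oo fps_X\<^sup>2 = 1 / (1 - fps_X ^ (2 * Suc k))" for k
    by (simp only:) (subst fps_inverse_compose[OF X], simp, simp only: fps_compose_sub_distrib pow fps_compose_1)
  have "real_count 0 (2 * n) = fps_nth (\<Prod>k\<le>2 * n. (1 / (1 - fps_X ^ (2 * Suc k))) ^ 12) (2 * n)"
    by (simp add: real_count_nonpos)
  also have "(\<Prod>k\<le>2 * n. (1 / (1 - fps_X ^ (2 * Suc k))) ^ 12) = (\<Prod>k\<le>2 * n. ?q k ^ 12) oo fps_X\<^sup>2"
    by (simp only: fps_compose_prod_distrib[OF X] fps_compose_power[OF X, symmetric] q)
  also have "fps_nth \<dots> (2 * n) = fps_nth (\<Prod>k\<le>2 * n. ?q k ^ 12) n"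
    by (rule fps_nth_compose_square)
  also have "\<dots> = fps_nth (\<Prod>k\<le>n. ?q k ^ 12) n"
    by (intro fps_nth_prod_stable one_mod_X_power one_mod_X_geometric) auto
  finally show ?thesis .
qed

section \<open>Growth of the curve counts\<close>

text \<open>
  The first product contributes \<open>pi\<^sup>2 / 12\<close> for each of the \<open>- e_R\<close> powers, and the second one the same for
  each of the \<open>12 - e_R / 2\<close> powers.
\<close>

lemma real_count_neg_asymptotics:
  fixes e_R :: int
  assumes "even e_R" "e_R < 0"
  shows "\<forall>\<^sub>F n in sequentially. real_count e_R n > 0"
    and "(\<lambda>n. ln (real_count e_R n)) \<sim>[sequentially] (\<lambda>n. pi * sqrt (4 * (e_C - 3 * e_R) / e_C * n))"
proof -
  let ?a = "nat (- e_R)" and ?b = "nat ((24 - e_R) div 2)"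
  obtain k where k: "e_R = 2 * k" using assms(1) by (elim evenE)
  then have half: "(24 - e_R) div 2 = 12 - k" by simp
  have a: "2 \<le> ?a" and b: "1 \<le> ?b" using assms k half by auto
  have D: "(\<lambda>k. ln (1 + exp (- t) ^ Suc k)) sums (log_euler t - log_euler (2 * t))" if "t > 0" for t
    using that by (rule log_distinct_sums)
  have lim: "((\<lambda>t. t * (log_euler t - log_euler (2 * t))) \<longlongrightarrow> pi\<^sup>2 / 12) (at_right 0)"
    using tendsto_diff[OF log_euler_at_0 log_euler_scaled_at_0[of 2]] by (simp add: algebra_simps)
  have \<delta>: "pi\<^sup>2 / 12 > 0" by simp
  have eq: "real_count e_R = (\<lambda>n. fps_nth (\<Prod>k\<le>n. (1 + fps_X ^ Suc k) ^ ?a * (1 / (1 - fps_X ^ (2 * Suc k))) ^ ?b) n)"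
    using assms by (intro ext real_count_nonpos) simp
  show "\<forall>\<^sub>F n in sequentially. real_count e_R n > 0"
    unfolding eq by (rule distinct_partition_asymptotics(1)[OF a b _ _ D lim \<delta>]) simp_all
  have "real ?b = 12 - e_R / 2"
    using assms k half by simp
  then have C: "?a * (pi\<^sup>2 / 12) + ?b * (pi\<^sup>2 / 12) = (pi / 2)\<^sup>2 * (4 * (e_C - 3 * e_R) / e_C)"
    using assms by (simp add: field_simps)
  have rate: "2 * sqrt ((?a * (pi\<^sup>2 / 12) + ?b * (pi\<^sup>2 / 12)) * n) = pi * sqrt (4 * (e_C - 3 * e_R) / e_C * n)" for n :: nat
    unfolding C by (simp only: mult.assoc real_sqrt_mult[of "(pi / 2)\<^sup>2"]) simp
  show "(\<lambda>n. ln (real_count e_R n)) \<sim>[sequentially] (\<lambda>n. pi * sqrt (4 * (e_C - 3 * e_R) / e_C * n))"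
    unfolding eq rate[symmetric]
    by (rule distinct_partition_asymptotics(2)[OF a b _ _ D lim \<delta>]) simp_all
qed

text \<open>
  The growth rate does not depend on \<open>e_R\<close>: the \<open>e_R\<close> powers of the first product contribute
  \<open>pi\<^sup>2 / 24\<close> each and the \<open>12 - e_R / 2\<close> powers of the second one \<open>pi\<^sup>2 / 12\<close> each, in total \<open>pi\<^sup>2\<close>.
\<close>

lemma real_count_pos_asymptotics:
  fixes e_R :: int
  assumes "even e_R" "0 < e_R" "e_R \<le> 20"
  shows "\<forall>\<^sub>F n in sequentially. real_count e_R n \<noteq> 0"
    and "(\<lambda>n. ln \<bar>real_count e_R n\<bar>) \<sim>[sequentially] (\<lambda>n. 2 * pi * sqrt n)"
proof -
  let ?a = "nat e_R" and ?b = "nat ((24 - e_R) div 2)"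
  let ?v = "\<lambda>n. fps_nth (\<Prod>k\<le>n. (1 + fps_X ^ Suc (2 * k)) ^ ?a * (1 / (1 - fps_X ^ (2 * Suc k))) ^ ?b) n :: real"
  obtain k where k: "e_R = 2 * k" using assms(1) by (elim evenE)
  then have half: "(24 - e_R) div 2 = 12 - k" by simp
  have a: "2 \<le> ?a" and b: "1 \<le> ?b" using assms k half by auto
  have D: "(\<lambda>k. ln (1 + exp (- t) ^ Suc (2 * k))) sums
      ((log_euler t - log_euler (2 * t)) - (log_euler (2 * t) - log_euler (4 * t)))" if "t > 0" for t
    using that by (rule log_odd_distinct_sums)
  have lim: "((\<lambda>t. t * ((log_euler t - log_euler (2 * t)) - (log_euler (2 * t) - log_euler (4 * t))))
      \<longlongrightarrow> pi\<^sup>2 / 24) (at_right 0)"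
    using tendsto_diff[OF tendsto_diff[OF log_euler_at_0 log_euler_scaled_at_0[of 2]]
        tendsto_diff[OF log_euler_scaled_at_0[of 2] log_euler_scaled_at_0[of 4]]]
    by (simp add: algebra_simps)
  have \<delta>: "pi\<^sup>2 / 24 > 0" by simp
  have pos: "\<forall>\<^sub>F n in sequentially. ?v n > 0"
    by (rule distinct_partition_asymptotics(1)[OF a b _ _ D lim \<delta>]) simp_all
  have v: "?v n = (-1) ^ n * real_count e_R n" for n
    using assms real_count_pos by simp
  show "\<forall>\<^sub>F n in sequentially. real_count e_R n \<noteq> 0"
    using pos unfolding v by (auto elim: eventually_mono)
  have abs: "\<bar>real_count e_R n\<bar> = \<bar>?v n\<bar>" for n
    unfolding v by (simp add: abs_mult power_abs)
  have "real ?b = 12 - e_R / 2"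
    using assms k half by simp
  then have C: "?a * (pi\<^sup>2 / 24) + ?b * (pi\<^sup>2 / 12) = pi\<^sup>2"
    using assms by (simp add: field_simps)
  have rate: "2 * sqrt ((?a * (pi\<^sup>2 / 24) + ?b * (pi\<^sup>2 / 12)) * n) = 2 * pi * sqrt n" for n :: nat
    unfolding C by (simp add: real_sqrt_mult)
  have v_asymp: "(\<lambda>n. ln (?v n)) \<sim>[sequentially] (\<lambda>n. 2 * pi * sqrt n)"
    unfolding rate[symmetric]
    by (rule distinct_partition_asymptotics(2)[OF a b _ _ D lim \<delta>]) simp_all
  have logs: "\<forall>\<^sub>F n in sequentially. ln \<bar>real_count e_R n\<bar> = ln (?v n)"
    using pos unfolding abs by (auto elim: eventually_mono)
  have "(\<lambda>n. ln \<bar>real_count e_R n\<bar>) \<sim>[sequentially] (\<lambda>n. 2 * pi * sqrt n) \<longleftrightarrow>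
      (\<lambda>n. ln (?v n)) \<sim>[sequentially] (\<lambda>n. 2 * pi * sqrt n)"
    by (rule asymp_equiv_cong[OF logs]) simp
  then show "(\<lambda>n. ln \<bar>real_count e_R n\<bar>) \<sim>[sequentially] (\<lambda>n. 2 * pi * sqrt n)"
    using v_asymp by (rule iffD2)
qed

lemma complex_count_asymptotics:
  shows "\<forall>\<^sub>F n in sequentially. complex_count n > 0"
    and "(\<lambda>n. ln (complex_count n)) \<sim>[sequentially] (\<lambda>n. 4 * pi * sqrt n)"
proof -
  have rate: "2 * sqrt (real 24 * (pi\<^sup>2 / 6) * n) = 4 * pi * sqrt n" for n :: nat
  proof -
    have "real 24 * (pi\<^sup>2 / 6) * n = (2 * pi)\<^sup>2 * n" by (simp add: power_mult_distrib)
    then show ?thesis by (simp only: real_sqrt_mult real_sqrt_abs) simp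
  qed
  show "\<forall>\<^sub>F n in sequentially. complex_count n > 0"
    unfolding complex_count_eq by (rule partition_power_asymptotics(1)) simp
  show "(\<lambda>n. ln (complex_count n)) \<sim>[sequentially] (\<lambda>n. 4 * pi * sqrt n)"
    unfolding complex_count_eq rate[symmetric] by (rule partition_power_asymptotics(2)) simp
qed

lemma real_count_zero_asymptotics:
  shows "\<forall>\<^sub>F n in sequentially. real_count 0 (2 * n) > 0"
    and "(\<lambda>n. ln (real_count 0 (2 * n))) \<sim>[sequentially] (\<lambda>n. 2 * pi * sqrt (real (2 * n)))"
proof -
  have rate: "2 * sqrt (real 12 * (pi\<^sup>2 / 6) * n) = 2 * pi * sqrt (real (2 * n))" for n :: nat
  proof -
    have "real 12 * (pi\<^sup>2 / 6) * n = pi\<^sup>2 * (2 * n)" by simp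
    then show ?thesis by (simp only: real_sqrt_mult real_sqrt_abs) simp
  qed
  show "\<forall>\<^sub>F n in sequentially. real_count 0 (2 * n) > 0"
    unfolding real_count_zero by (rule partition_power_asymptotics(1)) simp
  show "(\<lambda>n. ln (real_count 0 (2 * n))) \<sim>[sequentially] (\<lambda>n. 2 * pi * sqrt (real (2 * n)))"
    unfolding real_count_zero rate[symmetric] by (rule partition_power_asymptotics(2)) simp
qed

theorem theorem2p3:
  fixes e_R :: int
  assumes "even e_R" and "-18 \<le> e_R" and "e_R \<le> 20"
  defines "w \<equiv> real_count e_R" and "c \<equiv> complex_count"
  shows "(\<forall>\<^sub>F n in sequentially. c n > 0) \<and>
    (e_R < 0 \<longrightarrow>
      (\<forall>\<^sub>F n in sequentially. w n > 0) \<and>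
      (\<lambda>n. ln (w n)) \<sim>[sequentially] (\<lambda>n. pi * sqrt (4 * (e_C - 3 * e_R) / e_C * n)) \<and>
      (\<lambda>n. pi * sqrt (4 * (e_C - 3 * e_R) / e_C * n)) \<sim>[sequentially]
        (\<lambda>n. sqrt ((e_C - 3 * e_R) / (4 * e_C)) * ln (c n))) \<and>
    (e_R > 0 \<longrightarrow>
      (\<forall>\<^sub>F n in sequentially. w n \<noteq> 0) \<and>
      (\<lambda>n. ln \<bar>w n\<bar>) \<sim>[sequentially] (\<lambda>n. 2 * pi * sqrt n) \<and>
      (\<lambda>n. 2 * pi * sqrt n) \<sim>[sequentially] (\<lambda>n. 1 / 2 * ln (c n))) \<and>
    (e_R = 0 \<longrightarrow>
      (\<forall>\<^sub>F n in sequentially. w (2 * n) > 0) \<and>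
      (\<lambda>n. ln (w (2 * n))) \<sim>[sequentially] (\<lambda>n. 1 / 2 * ln (c (2 * n))))"
proof -
  have scaled: "(\<lambda>n. r * (4 * pi * sqrt n)) \<sim>[sequentially] (\<lambda>n. r * ln (c n))" for r :: real
    unfolding c_def by (intro asymp_equiv_intros asymp_equiv_symI[OF complex_count_asymptotics(2)])
  have rate: "pi * sqrt (4 * (e_C - 3 * e_R) / e_C * n) = sqrt ((e_C - 3 * e_R) / (4 * e_C)) * (4 * pi * sqrt n)" for n :: nat
  proof -
    have "sqrt (4 * (e_C - 3 * e_R) / e_C * n) = sqrt (4\<^sup>2 * ((e_C - 3 * e_R) / (4 * e_C)) * n)"
      by simp
    also have "\<dots> = 4 * sqrt ((e_C - 3 * e_R) / (4 * e_C)) * sqrt n"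
      by (simp only: real_sqrt_mult) simp
    finally show ?thesis by simp
  qed
  have neg: "(\<lambda>n. pi * sqrt (4 * (e_C - 3 * e_R) / e_C * n)) \<sim>[sequentially]
      (\<lambda>n. sqrt ((e_C - 3 * e_R) / (4 * e_C)) * ln (c n))"
    unfolding rate by (rule scaled)
  have half: "(\<lambda>n. 2 * pi * sqrt n) \<sim>[sequentially] (\<lambda>n. 1 / 2 * ln (c n))"
    using scaled[of "1 / 2"] by (simp add: mult.assoc)
  have "filterlim (\<lambda>n::nat. 2 * n) sequentially sequentially"
    by (intro filterlim_subseq) (simp add: strict_mono_def)
  from asymp_equiv_compose'[OF half this]
  have half_even: "(\<lambda>n. 2 * pi * sqrt (real (2 * n))) \<sim>[sequentially] (\<lambda>n. 1 / 2 * ln (c (2 * n)))"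
    by simp
  have "(\<lambda>n. ln (w (2 * n))) \<sim>[sequentially] (\<lambda>n. 1 / 2 * ln (c (2 * n)))" if "e_R = 0"
    using asymp_equiv_trans[OF real_count_zero_asymptotics(2) half_even] that by (simp add: w_def)
  then show ?thesis
    using complex_count_asymptotics(1) real_count_neg_asymptotics[OF assms(1)]
      real_count_pos_asymptotics[OF assms(1) _ assms(3)] real_count_zero_asymptotics(1) neg half
    unfolding w_def c_def by simp
qed

end
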